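(* If $m$ is the minimum number of bicliques with component size at most $x$ needed to cover a complete graph $K_n$, then $$m = \Theta\left(\left(\frac{n}{x}\right)^2 + \left(\frac{n}{x}\right)\log x\right).$$
   Context: All logarithms are taken base $2$. $K_n$ denotes the complete graph on $n$ vertices. An (undirected) biclique $K_{a,b}$ is a graph whose vertices are partitioned into two sets, of $a$ and $b$ vertices respectively, such that every vertex of the first set is connected to every vertex of the second set and no two vertices in the same set have an edge between them. These two independent sets are called the two components of the biclique, and component size means the number of vertices in a component. Covering means edge-covering: a collection of bicliques on vertices of $K_n$ covers $K_n$ if every edge of $K_n$ belongs to at least one biclique in the collection.
   Formalization: The bound is stated for integers n ≥ 2 and 1 ≤ x ≤ n, with constants uniform in n and x; for x much larger than n (e.g. x = n²) the right side tends to 0 while m = ⌈log n⌉, and for n = x = 1 one has m = 0 but right side 1. *)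

theory Defs
  imports
    Complex_Main
    "HOL-Library.Landau_Symbols"
    "Graph_Theory.Graph_Theory"
begin

text \<open>
  Undirected graphs are symmetric digraphs, as in the theory Kuratowski of the AFP entry
  Graph\_Theory, which provides the predicates for being a complete graph and for being a
  biclique used below. The coercion from
  \<^typ>\<open>'a pair_pre_digraph\<close> to \<^typ>\<open>('a, 'a \<times> 'a) pre_digraph\<close> is inserted automatically.
\<close>

definition complete_graph :: "nat \<Rightarrow> nat pair_pre_digraph" where
  "complete_graph n = \<lparr> pverts = {..<n}, parcs = {(u, v). u < n \<and> v < n \<and> u \<noteq> v} \<rparr>"

lemma complete_digraph_complete_graph: "K\<^bsub>n\<^esub> (complete_graph n)"
  by (auto simp: complete_digraph_pair_def complete_graph_def)

text \<open>
  In a complete graph, the subgraph condition only says that the vertices of the biclique are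
  vertices of the complete graph.
\<close>

definition is_biclique_cover :: "'a pair_pre_digraph \<Rightarrow> nat \<Rightarrow> 'a pair_pre_digraph set \<Rightarrow> bool" where
  "is_biclique_cover G x C \<longleftrightarrow> finite C
    \<and> (\<forall>B\<in>C. subgraph B G \<and> (\<exists>a b. K\<^bsub>a,b\<^esub> B \<and> a \<le> x \<and> b \<le> x))
    \<and> (\<forall>e\<in>parcs G. \<exists>B\<in>C. e \<in> parcs B)"

definition biclique_cover_number :: "'a pair_pre_digraph \<Rightarrow> nat \<Rightarrow> nat" where
  "biclique_cover_number G x = (LEAST m. \<exists>C. is_biclique_cover G x C \<and> card C = m)"

lemma subgraph_complete_graph_iff:
  assumes "K\<^bsub>a,b\<^esub> (with_proj B)"
  shows "subgraph B (complete_graph n) \<longleftrightarrow> pverts B \<subseteq> {..<n}"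
proof -
  interpret graph "with_proj B" using assms by (simp add: complete_bipartite_digraph_def)
  interpret K: graph "with_proj (complete_graph n)"
    using complete_digraph_complete_graph by (simp add: complete_digraph_def)
  have "parcs B \<subseteq> parcs (complete_graph n)" if "pverts B \<subseteq> {..<n}"
    using that assms unfolding complete_bipartite_digraph_pair_def
    by (auto simp: complete_graph_def)
  then show ?thesis
    using wf_digraph_axioms K.wf_digraph_axioms
    by (auto simp: subgraph_def compatible_def complete_graph_def)
qed

text \<open>The minimum is attained: the edges themselves form a cover by bicliques with \<open>a = b = 1\<close>.\<close>

lemma is_biclique_cover_exists:
  assumes "x \<ge> 1"
  shows "\<exists>C. is_biclique_cover (complete_graph n) x C"
proof -
  define B where "B = (\<lambda>(u::nat, v). \<lparr> pverts = {u, v}, parcs = {(u, v), (v, u)} \<rparr>)"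
  have K: "K\<^bsub>1,1\<^esub> (with_proj (B (u, v)))" if "u \<noteq> v" for u v
    unfolding complete_bipartite_digraph_pair_def
    by (rule conjI, simp add: B_def, rule exI[of _ "{u}"], rule exI[of _ "{v}"])
      (use that in \<open>auto simp: B_def\<close>)
  have P: "parcs (complete_graph n) \<subseteq> {..<n} \<times> {..<n}"
    by (auto simp: complete_graph_def)
  have "is_biclique_cover (complete_graph n) x (B ` parcs (complete_graph n))"
    unfolding is_biclique_cover_def
  proof (intro conjI ballI)
    show "finite (B ` parcs (complete_graph n))"
      using P by (meson finite_SigmaI finite_imageI finite_lessThan finite_subset)
  next
    fix b assume "b \<in> B ` parcs (complete_graph n)"
    then obtain u v where b: "b = B (u, v)" and uv: "u < n" "v < n" "u \<noteq> v"
      by (auto simp: complete_graph_def)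
    show "subgraph b (complete_graph n)"
      using subgraph_complete_graph_iff[OF K[OF uv(3)]] uv b by (auto simp: B_def)
    show "\<exists>a c. K\<^bsub>a,c\<^esub> (with_proj b) \<and> a \<le> x \<and> c \<le> x"
      using K[OF uv(3)] assms b by blast
  next
    fix e assume "e \<in> parcs (complete_graph n)"
    moreover have "e \<in> parcs (B e)" by (cases e) (simp add: B_def)
    ultimately show "\<exists>b\<in>B ` parcs (complete_graph n). e \<in> parcs b" by blast
  qed
  then show ?thesis by blast
qed

end

theory Submission
  imports Defs
begin

text \<open>
  For the upper bound, split the vertices into blocks of at most \<open>x\<close> vertices: one biclique for
  each pair of blocks covers the edges between blocks, and inside a block one biclique for each
  binary digit suffices. For the lower bound, a biclique covers at most \<open>x\<^sup>2\<close> edges, which gives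
  the quadratic term. The other term is Hansel's argument: delete a random side of each biclique.
  A vertex lying in \<open>r\<close> bicliques survives with probability \<open>2\<^sup>-\<^sup>r\<close> and at most one vertex survives,
  so by convexity a vertex lies in at least \<open>log n\<close> bicliques on average.
\<close>

section \<open>Hansel's argument and the lower bounds\<close>

text \<open>The sum is the expected number of survivors when a random side of each \<open>i\<close>
  is deleted. Induction on \<open>I\<close> conditions on one choice: a pair inside
  \<open>S - V i\<close> or inside \<open>S - U i\<close> is not separated by \<open>i\<close>, so
  \<open>I\<close> without \<open>i\<close> still separates it, and the two conditional expectations
  are averaged.\<close>

lemma sum_half_power_separating_le_1:
  fixes U V :: "'i \<Rightarrow> 'v set"
  assumes "finite I" "finite S"
    and "\<And>i. i \<in> I \<Longrightarrow> U i \<inter> V i = {}"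
    and "\<And>u v. u \<in> S \<Longrightarrow> v \<in> S \<Longrightarrow> u \<noteq> v \<Longrightarrow> \<exists>i\<in>I. (u, v) \<in> U i \<times> V i \<union> V i \<times> U i"
  shows "(\<Sum>v\<in>S. (1/2::real) ^ card {i\<in>I. v \<in> U i \<union> V i}) \<le> 1"
  using assms
proof (induction I arbitrary: S rule: finite_induct)
  case empty
  then have "card S \<le> 1" by (auto simp: card_le_Suc0_iff_eq)
  then show ?case by simp
next
  case (insert i I)
  define w where "w v = (1/2::real) ^ card {j\<in>I. v \<in> U j \<union> V j}" for v
  have "(\<Sum>v\<in>S - V i. w v) \<le> 1"
    unfolding w_def by (rule insert.IH) (use insert.prems in fastforce)+
  moreover have "(\<Sum>v\<in>S - U i. w v) \<le> 1"
    unfolding w_def by (rule insert.IH) (use insert.prems in fastforce)+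
  \<comment> \<open>A vertex on one side of \<open>i\<close> survives exactly one of the two
    deletions, whence the extra factor 1/2; a vertex on neither side survives both and keeps its
    weight.\<close>
  moreover have half: "(1/2::real) ^ card {j\<in>insert i I. v \<in> U j \<union> V j}
      = (if v \<in> V i then 0 else w v) / 2 + (if v \<in> U i then 0 else w v) / 2" for v
  proof (cases "v \<in> U i \<union> V i")
    case True
    then have "{j\<in>insert i I. v \<in> U j \<union> V j} = insert i {j\<in>I. v \<in> U j \<union> V j}" by auto
    with True insert show ?thesis by (auto simp: w_def)
  next
    case False
    then have "{j\<in>insert i I. v \<in> U j \<union> V j} = {j\<in>I. v \<in> U j \<union> V j}" by auto
    with False show ?thesis by (simp add: w_def)
  qed
  moreover have "(\<Sum>v\<in>S. if v \<in> A then 0 else w v) = (\<Sum>v\<in>S - A. w v)" for A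
    using insert.prems(1) by (intro sum.mono_neutral_cong_right) auto
  ultimately show ?case
    by (simp add: half sum.distrib flip: sum_divide_distrib)
qed

lemma card_log_le_sum_card_separating:
  fixes U V :: "'i \<Rightarrow> 'v set"
  assumes "finite I" "finite S"
    and disj: "\<And>i. i \<in> I \<Longrightarrow> U i \<inter> V i = {}"
    and fin: "\<And>i. i \<in> I \<Longrightarrow> finite (U i \<union> V i)"
    and sep: "\<And>u v. u \<in> S \<Longrightarrow> v \<in> S \<Longrightarrow> u \<noteq> v \<Longrightarrow> \<exists>i\<in>I. (u, v) \<in> U i \<times> V i \<union> V i \<times> U i"
  shows "card S * log 2 (card S) \<le> (\<Sum>i\<in>I. real (card (U i \<union> V i)))"
proof (cases "S = {}")
  case True
  then show ?thesis by (simp add: sum_nonneg)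
next
  case False
  define n where "n = real (card S)"
  have n: "n > 0" using False assms(2) by (simp add: n_def card_gt_0_iff)
  define r where "r v = card {i\<in>I. v \<in> U i \<union> V i}" for v
  \<comment> \<open>Jensen's inequality in linear form: the left side is the tangent to
    \<open>2 powr (- r)\<close> at \<open>r = log 2 n\<close>, where the value is
    \<open>1 / n\<close>.\<close>
  have tangent: "(1 + ln n - real (r v) * ln 2) / n \<le> (1/2) ^ r v" for v
  proof -
    have "1 + (ln n - real (r v) * ln 2) \<le> exp (ln n - real (r v) * ln 2)"
      by (rule exp_ge_add_one_self)
    also have "\<dots> = n * (1/2) ^ r v"
      using n by (simp add: exp_diff exp_of_nat_mult power_divide)
    finally show ?thesis
      using n by (simp add: pos_divide_le_eq algebra_simps)
  qed
  have "(\<Sum>v\<in>S. (1 + ln n - real (r v) * ln 2) / n) \<le> (\<Sum>v\<in>S. (1/2) ^ r v)"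
    by (intro sum_mono tangent)
  also have "\<dots> \<le> 1"
    unfolding r_def by (rule sum_half_power_separating_le_1) (use assms in auto)
  finally have "n * (1 + ln n) - (\<Sum>v\<in>S. real (r v)) * ln 2 \<le> n"
    using n by (simp add: sum_subtractf n_def sum_distrib_right
        flip: sum_divide_distrib)
  then have "n * log 2 n \<le> (\<Sum>v\<in>S. real (r v))"
    by (simp add: log_def field_simps)
  \<comment> \<open>Double counting of the pairs of a vertex and an index whose sides contain
    it.\<close>
  also have "\<dots> = (\<Sum>v\<in>S. \<Sum>i | i \<in> I \<and> v \<in> U i \<union> V i. 1::real)"
    by (simp only: r_def sum_constant mult_1_right)
  also have "\<dots> = (\<Sum>i\<in>I. \<Sum>v | v \<in> S \<and> v \<in> U i \<union> V i. 1::real)"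
    by (rule sum.swap_restrict[OF assms(2,1)])
  also have "\<dots> \<le> (\<Sum>i\<in>I. real (card (U i \<union> V i)))"
    using fin by (auto intro!: sum_mono card_mono)
  finally show ?thesis by (simp add: n_def)
qed

text \<open>An undirected edge is two arcs, so \<open>complete_graph n\<close> has
  \<open>n * (n - 1)\<close> arcs and a biclique at most \<open>2 * x\<^sup>2\<close>. The second
  bound is Hansel's, since a biclique has at most \<open>2 * x\<close> vertices.\<close>

lemma biclique_cover_lower_bounds:
  assumes C: "is_biclique_cover (complete_graph n) x C"
  shows "real n * (real n - 1) \<le> 2 * real (card C) * (real x)\<^sup>2"
    and "real n * log 2 (real n) \<le> 2 * real (card C) * real x"
proof -
  have fin: "finite C" using C by (simp add: is_biclique_cover_def)
  have "\<forall>B\<in>C. \<exists>U V. finite U \<and> finite V \<and> U \<inter> V = {} \<and> card U \<le> x \<and> card V \<le> x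
      \<and> parcs B = U \<times> V \<union> V \<times> U"
  proof
    fix B assume "B \<in> C"
    then obtain a b where "K\<^bsub>a,b\<^esub> (with_proj B)" "a \<le> x" "b \<le> x"
      using C unfolding is_biclique_cover_def by blast
    then show "\<exists>U V. finite U \<and> finite V \<and> U \<inter> V = {} \<and> card U \<le> x \<and> card V \<le> x
        \<and> parcs B = U \<times> V \<union> V \<times> U"
      unfolding complete_bipartite_digraph_pair_def by (metis finite_Un)
  qed
  then obtain U V where UV: "\<And>B. B \<in> C \<Longrightarrow> finite (U B) \<and> finite (V B) \<and> U B \<inter> V B = {}
      \<and> card (U B) \<le> x \<and> card (V B) \<le> x \<and> parcs B = U B \<times> V B \<union> V B \<times> U B"
    by metis
  have sep: "\<exists>B\<in>C. (u, v) \<in> parcs B" if "u < n" "v < n" "u \<noteq> v" for u v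
    using C that by (auto simp: is_biclique_cover_def complete_graph_def)

  have "parcs (complete_graph n) \<subseteq> (\<Union>B\<in>C. parcs B)"
    using sep by (auto simp: complete_graph_def)
  moreover have "finite (parcs B)" if "B \<in> C" for B using UV[OF that] by simp
  ultimately have "card (parcs (complete_graph n)) \<le> card (\<Union>B\<in>C. parcs B)"
    using fin by (intro card_mono) auto
  also have "\<dots> \<le> (\<Sum>B\<in>C. card (parcs B))"
    by (rule card_UN_le[OF fin])
  also have "\<dots> \<le> (\<Sum>B\<in>C. 2 * x\<^sup>2)"
  proof (rule sum_mono)
    fix B assume "B \<in> C"
    note B = UV[OF this]
    have "card (parcs B) \<le> card (U B) * card (V B) + card (V B) * card (U B)"
      using B by (metis card_Un_le card_cartesian_product)
    also have "\<dots> \<le> x * x + x * x"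
      using B by (intro add_mono mult_mono) auto
    finally show "card (parcs B) \<le> 2 * x\<^sup>2" by (simp add: power2_eq_square)
  qed
  finally have le: "card (parcs (complete_graph n)) \<le> 2 * card C * x\<^sup>2" by simp
  have "parcs (complete_graph n) = {..<n} \<times> {..<n} - (\<lambda>v. (v, v)) ` {..<n}"
    by (auto simp: complete_graph_def)
  then have "card (parcs (complete_graph n)) = n * n - n"
    by (simp add: card_Diff_subset image_subset_iff card_image inj_on_def)
  \<comment> \<open>The truncated subtraction is removed before passing to the reals.\<close>
  with le have "n * n \<le> 2 * card C * x\<^sup>2 + n" by simp
  then have "real (n * n) \<le> real (2 * card C * x\<^sup>2 + n)" by (simp only: of_nat_le_iff)
  then show "real n * (real n - 1) \<le> 2 * real (card C) * (real x)\<^sup>2"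
    by (simp add: algebra_simps)

  have "card {..<n} * log 2 (card {..<n}) \<le> (\<Sum>B\<in>C. real (card (U B \<union> V B)))"
    by (rule card_log_le_sum_card_separating) (use UV sep fin in auto)
  also have "\<dots> \<le> (\<Sum>B\<in>C. real (2 * x))"
  proof (intro sum_mono of_nat_mono)
    fix B assume "B \<in> C"
    then show "card (U B \<union> V B) \<le> 2 * x"
      using UV[of B] card_Un_le[of "U B" "V B"] by simp
  qed
  finally show "real n * log 2 (real n) \<le> 2 * real (card C) * real x"
    by (simp add: mult_ac)
qed

section \<open>Construction of a cover\<close>

text \<open>Reduces a cover to an indexed family of pairs of sides. Sides may be empty and indices
  may repeat a biclique, so constructions need not treat degenerate cases.\<close>

lemma biclique_cover_number_le:
  fixes U V :: "'i \<Rightarrow> nat set"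
  assumes "finite I"
    and "\<And>i. i \<in> I \<Longrightarrow> U i \<union> V i \<subseteq> {..<n} \<and> U i \<inter> V i = {} \<and> card (U i) \<le> x \<and> card (V i) \<le> x"
    and "\<And>u v. u < n \<Longrightarrow> v < n \<Longrightarrow> u \<noteq> v \<Longrightarrow> \<exists>i\<in>I. (u, v) \<in> U i \<times> V i \<union> V i \<times> U i"
  shows "biclique_cover_number (complete_graph n) x \<le> card I"
proof -
  define B where "B i = \<lparr> pverts = U i \<union> V i, parcs = U i \<times> V i \<union> V i \<times> U i \<rparr>" for i
  have K: "K\<^bsub>card (U i),card (V i)\<^esub> (with_proj (B i))" if "i \<in> I" for i
    unfolding complete_bipartite_digraph_pair_def
    using assms(2)[OF that] finite_subset[of "U i \<union> V i" "{..<n}"]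
    by (auto simp: B_def)
  have "is_biclique_cover (complete_graph n) x (B ` I)"
    unfolding is_biclique_cover_def
  proof (intro conjI ballI)
    show "finite (B ` I)" using assms(1) by simp
  next
    fix b assume "b \<in> B ` I"
    then obtain i where i: "i \<in> I" "b = B i" by auto
    show "subgraph b (complete_graph n)"
      using subgraph_complete_graph_iff[OF K[OF i(1)]] assms(2)[OF i(1)] i(2)
      by (simp add: B_def)
    show "\<exists>a c. K\<^bsub>a,c\<^esub> (with_proj b) \<and> a \<le> x \<and> c \<le> x"
      using K[OF i(1)] assms(2)[OF i(1)] i(2) by blast
  next
    fix e assume "e \<in> parcs (complete_graph n)"
    then show "\<exists>b\<in>B ` I. e \<in> parcs b"
      using assms(3) by (auto simp: complete_graph_def B_def)
  qed
  then have "biclique_cover_number (complete_graph n) x \<le> card (B ` I)"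
    unfolding biclique_cover_number_def by (intro Least_le) blast
  then show ?thesis using card_image_le[OF assms(1), of B] by linarith
qed

lemma biclique_cover_number_complete_graph_le:
  assumes "x > 0" "x \<le> 2 ^ l"
  shows "biclique_cover_number (complete_graph n) x \<le> (n div x + 1)\<^sup>2 + (n div x + 1) * l"
proof -
  \<comment> \<open>Rounds the number of blocks up; the last block is empty when \<open>x\<close>
    divides \<open>n\<close>.\<close>
  define k where "k = n div x + 1"
  define block where "block i = {v. v < n \<and> v div x = i}" for i
  define digit where "digit b j = {v. bit (v mod x) j = b}" for b j
  \<comment> \<open>\<open>Inl (i, j)\<close> joins two distinct blocks; ordered pairs repeat each
    biclique, at the cost of a constant factor. \<open>Inr (i, j)\<close> splits block
    \<open>i\<close> by the binary digit \<open>j\<close> of the residue modulo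
    \<open>x\<close>.\<close>
  define I :: "((nat \<times> nat) + (nat \<times> nat)) set" where
    "I = ({..<k} \<times> {..<k} - Id) <+> ({..<k} \<times> {..<l})"
  define U where "U = case_sum (\<lambda>(i, _::nat). block i) (\<lambda>(i, j). block i \<inter> digit True j)"
  define V where "V = case_sum (\<lambda>(_::nat, j). block j) (\<lambda>(i, j). block i \<inter> digit False j)"
  have fin: "finite I" by (simp add: I_def)
  have block: "card (block i) \<le> x" "finite (block i)" "card (block i \<inter> A) \<le> x" for i A
  proof -
    show f: "finite (block i)" by (simp add: block_def)
    have "block i \<subseteq> {i * x..<i * x + x}"
      using assms(1) by (auto simp: block_def add.commute[of _ x] dividend_less_div_times)
    then show "card (block i) \<le> x"
      using card_mono[of "{i * x..<i * x + x}" "block i"] by simp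
    then show "card (block i \<inter> A) \<le> x"
      using card_mono[OF f, of "block i \<inter> A"] by simp
  qed
  have "biclique_cover_number (complete_graph n) x \<le> card I"
  proof (rule biclique_cover_number_le[OF fin])
    fix i assume "i \<in> I"
    then show "U i \<union> V i \<subseteq> {..<n} \<and> U i \<inter> V i = {} \<and> card (U i) \<le> x \<and> card (V i) \<le> x"
      using block by (auto simp: I_def U_def V_def) (auto simp: block_def digit_def)
  next
    fix u v assume uv: "u < n" "v < n" "u \<noteq> v"
    have k: "u div x < k" "v div x < k"
      using uv by (auto simp: k_def less_Suc_eq_le intro: div_le_mono)
    show "\<exists>i\<in>I. (u, v) \<in> U i \<times> V i \<union> V i \<times> U i"
    proof (cases "u div x = v div x")
      case False
      then show ?thesis
        using k uv by (intro bexI[of _ "Inl (u div x, v div x)"])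
          (auto simp: I_def U_def V_def block_def)
    next
      case True
      then have "u mod x \<noteq> v mod x" using uv(3) by (metis div_mult_mod_eq)
      moreover have "u mod x < 2 ^ l" "v mod x < 2 ^ l"
        using assms by (meson mod_less_divisor order_less_le_trans)+
      \<comment> \<open>Both residues are below \<open>2 ^ l\<close>, so \<open>take_bit l\<close>
        fixes them and distinct residues differ in a digit below \<open>l\<close>.\<close>
      ultimately obtain j where "j < l" "bit (u mod x) j \<noteq> bit (v mod x) j"
        by (metis bit_take_bit_iff bit_eq_iff take_bit_nat_eq_self)
      then show ?thesis
        using k uv True by (intro bexI[of _ "Inr (u div x, j)"])
          (auto simp: I_def U_def V_def block_def digit_def)
    qed
  qed
  also have "card I = card ({..<k} \<times> {..<k} - Id) + k * l"
    by (simp add: I_def card_Plus card_cartesian_product)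
  also have "card ({..<k} \<times> {..<k} - Id) \<le> card ({..<k} \<times> {..<k})"
    by (intro card_mono) auto
  finally show ?thesis by (simp add: k_def card_cartesian_product power2_eq_square)
qed

section \<open>Comparison of the bounds\<close>

theorem theorem1p1:
  shows "(\<lambda>(n, x). real (biclique_cover_number (complete_graph n) x))
    \<in> \<Theta>[principal {(n, x). 2 \<le> n \<and> 1 \<le> x \<and> x \<le> n}](
      \<lambda>(n, x). (real n / real x)\<^sup>2 + (real n / real x) * log 2 (real x))"
proof -
  \<comment> \<open>Under the \<open>principal\<close> filter the bounds must hold for every
    admissible pair. The lower estimates add up to \<open>6 * m\<close>, so 1/8 leaves
    slack.\<close>
  have "1/8 * norm ((real n / real x)\<^sup>2 + (real n / real x) * log 2 (real x))
        \<le> norm (real (biclique_cover_number (complete_graph n) x))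
      \<and> norm (real (biclique_cover_number (complete_graph n) x))
        \<le> 6 * norm ((real n / real x)\<^sup>2 + (real n / real x) * log 2 (real x))"
    if nx: "2 \<le> n" "1 \<le> x" "x \<le> n" for n x
  proof -
    define m where "m = biclique_cover_number (complete_graph n) x"
    define q where "q = real n / real x"
    have q: "q \<ge> 1" using nx by (simp add: q_def)
    have log0: "log 2 (real x) \<ge> 0" using nx by simp
    obtain C where C: "is_biclique_cover (complete_graph n) x C" "card C = m"
      unfolding m_def biclique_cover_number_def
      using LeastI_ex[of "\<lambda>m. \<exists>C. is_biclique_cover (complete_graph n) x C \<and> card C = m"]
        is_biclique_cover_exists[OF nx(2)] by blast

    \<comment> \<open>This is where \<open>n\<close> must be at least 2.\<close>
    have "(real n)\<^sup>2 \<le> 2 * (real n * (real n - 1))"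
      using nx(1) by (simp add: power2_eq_square algebra_simps)
    also have "\<dots> \<le> 4 * real m * (real x)\<^sup>2"
      using biclique_cover_lower_bounds(1)[OF C(1)] C(2) by simp
    finally have lower1: "q\<^sup>2 \<le> 4 * real m"
      using nx(2) by (simp add: q_def field_simps)
    \<comment> \<open>Hansel's bound involves \<open>log 2 n\<close>; the hypothesis
      \<open>x \<le> n\<close> weakens it to \<open>log 2 x\<close>.\<close>
    have "real n * log 2 (real x) \<le> real n * log 2 (real n)"
      using nx by (intro mult_left_mono) auto
    also have "\<dots> \<le> 2 * real m * real x"
      using biclique_cover_lower_bounds(2)[OF C(1)] C(2) by simp
    finally have lower2: "q * log 2 (real x) \<le> 2 * real m"
      using nx(2) by (simp add: q_def field_simps)

    define l where "l = nat \<lceil>log 2 (real x)\<rceil>"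
    have l: "log 2 (real x) \<le> real l" "real l \<le> log 2 (real x) + 1"
      using log0 unfolding l_def by linarith+
    have "real x \<le> 2 powr real l"
      using l(1) nx(2) by (simp add: log_le_iff)
    then have "real x \<le> real (2 ^ l)" by (simp add: powr_realpow)
    then have "x \<le> 2 ^ l" by (simp only: of_nat_le_iff)
    then have "m \<le> (n div x + 1)\<^sup>2 + (n div x + 1) * l"
      unfolding m_def using nx(2) by (intro biclique_cover_number_complete_graph_le) auto
    then have "real m \<le> real ((n div x + 1)\<^sup>2 + (n div x + 1) * l)"
      by (simp only: of_nat_le_iff)
    also have "\<dots> = (real (n div x) + 1)\<^sup>2 + (real (n div x) + 1) * real l"
      by (simp add: power2_eq_square algebra_simps)
    \<comment> \<open>Rounding up the blocks and the digits costs 1 each; as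
      \<open>1 \<le> q\<close>, the first is absorbed in \<open>2 * q\<close>.\<close>
    also have "\<dots> \<le> (2 * q)\<^sup>2 + (2 * q) * (log 2 (real x) + 1)"
    proof -
      have "real (n div x) \<le> q"
        unfolding q_def by (rule of_nat_div_le_of_nat)
      then have "real (n div x) + 1 \<le> 2 * q" using q by simp
      then show ?thesis
        using l(2) q by (intro add_mono power_mono mult_mono) auto
    qed
    also have "\<dots> = 4 * q\<^sup>2 + 2 * q + 2 * (q * log 2 (real x))"
      by (simp add: power2_eq_square algebra_simps)
    \<comment> \<open>The stray \<open>2 * q\<close> is at most \<open>2 * q\<^sup>2\<close>, which
      gives the constant \<open>6 = 4 + 2\<close>.\<close>
    also have "\<dots> \<le> 6 * (q\<^sup>2 + q * log 2 (real x))"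
    proof -
      have "q \<le> q\<^sup>2" using q by (simp add: power2_eq_square)
      moreover have "0 \<le> q * log 2 (real x)" using q log0 by simp
      ultimately show ?thesis by (simp add: algebra_simps)
    qed
    finally have upper: "real m \<le> 6 * (q\<^sup>2 + q * log 2 (real x))" .

    have "0 \<le> q\<^sup>2 + q * log 2 (real x)" using q log0 by simp
    then show ?thesis
      using lower1 lower2 upper unfolding m_def[symmetric] q_def[symmetric] by simp
  qed
  then show ?thesis
    by (intro bigthetaI'[of "1/8" 6]) (auto simp: eventually_principal)
qed

end
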